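(* Let $X_1,X_2,X_3\subset\mathbb{R}^d$ be compact and let $\mu_i\in\mathcal{P}(X_i)$, $i=1,2,3$, satisfy $\mu_1\preceq_c\mu_2\preceq_c\mu_3$. Suppose that $\pi^{12}=\mu_2\otimes\kappa_2^1\in\Pi_M(\mu_1,\mu_2)$ and $\pi^{23}=\mu_2\otimes\kappa_2^3\in\Pi_M(\mu_2,\mu_3)$ are two martingale couplings, where $\kappa_2^1(x_2,dx_1)$ and $\kappa_2^3(x_2,dx_3)$ are their conditional probabilities given $x_2$. Then the set of martingale couplings $\pi^{123}\in\Pi_M(\mu_1,\mu_2,\mu_3)$ such that $$\mathrm{Proj}_{12}(\pi^{123})=\pi^{12},\qquad \mathrm{Proj}_{23}(\pi^{123})=\pi^{23}$$ is given by $$\{\pi^{123}\in\Pi_M(\mu_1,\mu_2,\mu_3):\ \pi^{123}=\mu_2\otimes\kappa_2^{13},\ \kappa_2^{13}(x_2,dx_1,dx_3)\in\Pi^{\mathrm{Bar}}(F_{x_2},\kappa_2^1(x_2,\cdot),\kappa_2^3(x_2,\cdot))\ \text{for } \mu_2\text{-a.e. } x_2\},$$ where, for each fixed $x_2$, $F_{x_2}:X_1\to\mathbb{R}^d$ is the constant function $F_{x_2}(x_1)=x_2$.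
   Context: $\mathcal{P}(X)$ is the set of Borel probability measures on $X$. Convex order: $\mu\preceq_c\nu$ means $\int\varphi\,d\mu\le\int\varphi\,d\nu$ for all convex $\varphi:\mathbb{R}^d\to\mathbb{R}$. $\Pi(\mu_1,\dots,\mu_n)$ is the set of probability measures on $X_1\times\dots\times X_n$ with $i$-th marginal $\mu_i$ for every $i$. $\mathrm{Proj}_I(\pi)$ is the projection (marginal) of $\pi$ onto the coordinates indexed by $I$. $\mu\otimes\kappa$ denotes the joint measure obtained from a marginal $\mu$ and a conditional probability kernel $\kappa$ (disintegration); $\kappa_I^{J}$ is the conditional probability of the variables indexed by $J$ given those indexed by $I$. Martingale couplings: $\Pi_M(\mu_1,\dots,\mu_n)$ is the set of $\pi\in\Pi(\mu_1,\dots,\mu_n)$ such that for each $i=1,\dots,n-1$, disintegrating $\pi=\mathrm{Proj}_{1\dots i}(\pi)\otimes\kappa_{1\dots i}^{i+1,\dots,n}$, one has $\int x_{i+1}\,\kappa_{1\dots i}^{i+1,\dots,n}(x_1,\dots,x_i,dx_{i+1},\dots,dx_n)=x_i$ for $\mathrm{Proj}_{1\dots i}(\pi)$-almost every $(x_1,\dots,x_i)$. For probability measures $\sigma,\tau$ on compact sets $A,B\subset\mathbb{R}^d$ and a map $F:A\to\mathbb{R}^d$, $\Pi^{\mathrm{Bar}}(F,\sigma,\tau)$ is the set of $\pi=\sigma\otimes\kappa\in\Pi(\sigma,\tau)$ such that $\int b\,\kappa(a,db)=F(a)$ for $\sigma$-a.e. $a\in A$. *)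

theory Defs
  imports "HOL-Probability.Probability"
begin

(* A Borel measure on X is a measure on restrict_space borel X. Since the Euclidean topology
   is second countable, the product sigma-algebras used for couplings are the Borel
   sigma-algebras of the product sets. *)
definition borel_probs :: "'a::euclidean_space set \<Rightarrow> 'a measure set" where
  "borel_probs X = space (prob_algebra (restrict_space borel X))"

definition convex_order :: "'a::euclidean_space measure \<Rightarrow> 'a measure \<Rightarrow> bool"
    (infix "\<preceq>\<^sub>c" 50) where
  "\<mu> \<preceq>\<^sub>c \<nu> \<longleftrightarrow>
    (\<forall>\<phi>::'a \<Rightarrow> real. convex_on UNIV \<phi> \<longrightarrow> (\<integral>x. \<phi> x \<partial>\<mu>) \<le> (\<integral>x. \<phi> x \<partial>\<nu>))"

(* The joint law of (x, y), where x has law \<mu> and y has conditional law \<kappa> x on the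
   measurable space N (only the sigma-algebra of N is used). *)
definition kernel_prod :: "'a measure \<Rightarrow> 'b measure \<Rightarrow> ('a \<Rightarrow> 'b measure) \<Rightarrow> ('a \<times> 'b) measure" where
  "kernel_prod \<mu> N \<kappa> =
    bind \<mu> (\<lambda>x. bind (\<kappa> x) (\<lambda>y. return (\<mu> \<Otimes>\<^sub>M N) (x, y)))"

(* Writing \<pi> as the product of \<mu> and \<kappa> leaves the order of the coordinates implicit; here f
   selects the conditioning variables, with law \<mu>, and g the conditioned ones, with values
   in N. *)
definition disintegrates ::
    "'o measure \<Rightarrow> ('o \<Rightarrow> 'a) \<Rightarrow> 'a measure \<Rightarrow> ('o \<Rightarrow> 'b) \<Rightarrow> 'b measure \<Rightarrow> ('a \<Rightarrow> 'b measure) \<Rightarrow> bool" where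
  "disintegrates \<pi> f \<mu> g N \<kappa> \<longleftrightarrow>
    \<kappa> \<in> \<mu> \<rightarrow>\<^sub>M prob_algebra N \<and>
    distr \<pi> (\<mu> \<Otimes>\<^sub>M N) (\<lambda>\<omega>. (f \<omega>, g \<omega>)) = kernel_prod \<mu> N \<kappa>"

definition couplings2 :: "'a measure \<Rightarrow> 'b measure \<Rightarrow> ('a \<times> 'b) measure set" where
  "couplings2 \<mu>1 \<mu>2 =
    {\<pi> \<in> space (prob_algebra (\<mu>1 \<Otimes>\<^sub>M \<mu>2)). distr \<pi> \<mu>1 fst = \<mu>1 \<and> distr \<pi> \<mu>2 snd = \<mu>2}"

definition couplings3 ::
    "'a measure \<Rightarrow> 'b measure \<Rightarrow> 'c measure \<Rightarrow> ('a \<times> 'b \<times> 'c) measure set" where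
  "couplings3 \<mu>1 \<mu>2 \<mu>3 =
    {\<pi> \<in> space (prob_algebra (\<mu>1 \<Otimes>\<^sub>M (\<mu>2 \<Otimes>\<^sub>M \<mu>3))).
      distr \<pi> \<mu>1 (\<lambda>(x1, x2, x3). x1) = \<mu>1 \<and>
      distr \<pi> \<mu>2 (\<lambda>(x1, x2, x3). x2) = \<mu>2 \<and>
      distr \<pi> \<mu>3 (\<lambda>(x1, x2, x3). x3) = \<mu>3}"

definition proj12 ::
    "'a measure \<Rightarrow> 'b measure \<Rightarrow> ('a \<times> 'b \<times> 'c) measure \<Rightarrow> ('a \<times> 'b) measure" where
  "proj12 \<mu>1 \<mu>2 \<pi> = distr \<pi> (\<mu>1 \<Otimes>\<^sub>M \<mu>2) (\<lambda>(x1, x2, x3). (x1, x2))"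

definition proj23 ::
    "'b measure \<Rightarrow> 'c measure \<Rightarrow> ('a \<times> 'b \<times> 'c) measure \<Rightarrow> ('b \<times> 'c) measure" where
  "proj23 \<mu>2 \<mu>3 \<pi> = distr \<pi> (\<mu>2 \<Otimes>\<^sub>M \<mu>3) (\<lambda>(x1, x2, x3). (x2, x3))"

definition mart_couplings2 ::
    "'a::euclidean_space measure \<Rightarrow> 'a measure \<Rightarrow> ('a \<times> 'a) measure set" where
  "mart_couplings2 \<mu>1 \<mu>2 =
    {\<pi> \<in> couplings2 \<mu>1 \<mu>2.
      \<exists>\<kappa>. disintegrates \<pi> fst (distr \<pi> \<mu>1 fst) snd \<mu>2 \<kappa> \<and>
          (AE x1 in distr \<pi> \<mu>1 fst. (\<integral>x2. x2 \<partial>\<kappa> x1) = x1)}"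

(* The two conditions are the martingale property at the times i = 1 and i = 2. *)
definition mart_couplings3 ::
    "'a::euclidean_space measure \<Rightarrow> 'a measure \<Rightarrow> 'a measure \<Rightarrow> ('a \<times> 'a \<times> 'a) measure set" where
  "mart_couplings3 \<mu>1 \<mu>2 \<mu>3 =
    {\<pi> \<in> couplings3 \<mu>1 \<mu>2 \<mu>3.
      (\<exists>\<kappa>. disintegrates \<pi>
              (\<lambda>(x1, x2, x3). x1) (distr \<pi> \<mu>1 (\<lambda>(x1, x2, x3). x1))
              (\<lambda>(x1, x2, x3). (x2, x3)) (\<mu>2 \<Otimes>\<^sub>M \<mu>3) \<kappa> \<and>
           (AE x1 in distr \<pi> \<mu>1 (\<lambda>(x1, x2, x3). x1).
              (\<integral>(x2, x3). x2 \<partial>\<kappa> x1) = x1)) \<and>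
      (\<exists>\<kappa>. disintegrates \<pi>
              (\<lambda>(x1, x2, x3). (x1, x2)) (proj12 \<mu>1 \<mu>2 \<pi>)
              (\<lambda>(x1, x2, x3). x3) \<mu>3 \<kappa> \<and>
           (AE (x1, x2) in proj12 \<mu>1 \<mu>2 \<pi>. (\<integral>x3. x3 \<partial>\<kappa> (x1, x2)) = x2))}"

definition bary_couplings ::
    "('a::euclidean_space \<Rightarrow> 'a) \<Rightarrow> 'a measure \<Rightarrow> 'a measure \<Rightarrow> ('a \<times> 'a) measure set" where
  "bary_couplings F \<sigma> \<tau> =
    {\<pi> \<in> couplings2 \<sigma> \<tau>.
      \<exists>\<kappa>. disintegrates \<pi> fst \<sigma> snd \<tau> \<kappa> \<and> (AE a in \<sigma>. (\<integral>b. b \<partial>\<kappa> a) = F a)}"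

end

theory Submission
  imports Defs
begin

text \<open>
  No general disintegration theorem is needed. The martingale property at time 2 supplies a kernel
  \<open>K\<close> of \<open>x3\<close> given \<open>(x1, x2)\<close>. If \<open>\<pi>\<close> projects to \<open>\<pi>12\<close>, the joint law of \<open>(x1, x3)\<close> given
  \<open>x2\<close> is \<open>\<kappa>21 x2\<close> composed with \<open>K (\<cdot>, x2)\<close>, and the barycenter condition on it is exactly
  the martingale property of \<open>K\<close>. Its marginals are \<open>\<kappa>21 x2\<close> and \<open>\<kappa>23 x2\<close> for almost every
  \<open>x2\<close>, since kernels into a countably generated space are determined almost everywhere by the joint
  law. Conversely, the marginals of the kernel of \<open>(x1, x3)\<close> given \<open>x2\<close> determine the two
  projections.
\<close>

section \<open>Countable generation of trace Borel sigma-algebras\<close>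

lemma sets_restrict_borel_countably_generated:
  fixes X :: "'a::second_countable_topology set"
  assumes "X \<in> sets borel"
  obtains G where "countable G" "G \<subseteq> Pow X" "sets (restrict_space borel X) = sigma_sets X G"
proof -
  obtain B :: "'a set set" where B: "countable B" "topological_basis B"
    using ex_countable_basis by blast
  have "sets (restrict_space borel X) = (\<inter>) X ` sigma_sets UNIV B"
    unfolding sets_restrict_space borel_eq_countable_basis[OF B] by simp
  \<comment> \<open>Because \<open>X\<close> is Borel, taking traces on \<open>X\<close> commutes
    with generating a sigma-algebra, so the traces of a countable basis generate.\<close>
  also have "\<dots> = sigma_sets X ((\<inter>) X ` B)"
    using assms by (intro sigma_sets_Int) (auto simp: borel_eq_countable_basis[OF B])
  finally show ?thesis
    using B(1) by (intro that[of "(\<inter>) X ` B"]) auto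
qed

section \<open>Products of a measure with a probability kernel\<close>

lemma prob_kernelD:
  assumes "\<kappa> \<in> M \<rightarrow>\<^sub>M prob_algebra N" "x \<in> space M"
  shows "prob_space (\<kappa> x)" "sets (\<kappa> x) = sets N" "space (\<kappa> x) = space N"
  using measurable_space[OF assms] by (auto simp: space_prob_algebra dest: sets_eq_imp_space_eq)

lemma measurable_bind_return_pair:
  assumes [measurable]: "\<kappa> \<in> M \<rightarrow>\<^sub>M prob_algebra N"
  shows "(\<lambda>x. bind (\<kappa> x) (\<lambda>y. return (M \<Otimes>\<^sub>M N) (x, y))) \<in> M \<rightarrow>\<^sub>M prob_algebra (M \<Otimes>\<^sub>M N)"
  by measurable

lemma sets_kernel_prod:
  assumes "\<kappa> \<in> M \<rightarrow>\<^sub>M prob_algebra N" "space M \<noteq> {}"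
  shows "sets (kernel_prod M N \<kappa>) = sets (M \<Otimes>\<^sub>M N)"
  unfolding kernel_prod_def
  by (rule sets_bind)
    (use prob_kernelD[OF measurable_bind_return_pair[OF assms(1)]] assms(2) in auto)

lemma nn_integral_kernel_prod:
  assumes \<kappa>: "\<kappa> \<in> M \<rightarrow>\<^sub>M prob_algebra N" and f: "f \<in> borel_measurable (M \<Otimes>\<^sub>M N)"
  shows "(\<integral>\<^sup>+z. f z \<partial>kernel_prod M N \<kappa>) = (\<integral>\<^sup>+x. \<integral>\<^sup>+y. f (x, y) \<partial>\<kappa> x \<partial>M)"
proof -
  have *: "(\<integral>\<^sup>+z. f z \<partial>bind (\<kappa> x) (\<lambda>y. return (M \<Otimes>\<^sub>M N) (x, y))) = (\<integral>\<^sup>+y. f (x, y) \<partial>\<kappa> x)"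
    if x: "x \<in> space M" for x
  proof -
    note sets[measurable_cong] = prob_kernelD(2)[OF \<kappa> x]
    have [measurable]: "Pair x \<in> \<kappa> x \<rightarrow>\<^sub>M M \<Otimes>\<^sub>M N"
      using measurable_Pair1'[OF x, of N] measurable_cong_sets[OF sets refl] by blast
    have "(\<integral>\<^sup>+z. f z \<partial>bind (\<kappa> x) (\<lambda>y. return (M \<Otimes>\<^sub>M N) (x, y)))
        = (\<integral>\<^sup>+y. \<integral>\<^sup>+z. f z \<partial>return (M \<Otimes>\<^sub>M N) (x, y) \<partial>\<kappa> x)"
      by (rule nn_integral_bind[OF f]) measurable
    also have "\<dots> = (\<integral>\<^sup>+y. f (x, y) \<partial>\<kappa> x)"
      using prob_kernelD(3)[OF \<kappa> x] x
      by (intro nn_integral_cong nn_integral_return f) (auto simp: space_pair_measure)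
    finally show ?thesis .
  qed
  have "(\<integral>\<^sup>+z. f z \<partial>kernel_prod M N \<kappa>)
      = (\<integral>\<^sup>+x. \<integral>\<^sup>+z. f z \<partial>bind (\<kappa> x) (\<lambda>y. return (M \<Otimes>\<^sub>M N) (x, y)) \<partial>M)"
    unfolding kernel_prod_def
    by (rule nn_integral_bind[OF f])
      (rule measurable_prob_algebraD[OF measurable_bind_return_pair[OF \<kappa>]])
  also have "\<dots> = (\<integral>\<^sup>+x. \<integral>\<^sup>+y. f (x, y) \<partial>\<kappa> x \<partial>M)"
    by (intro nn_integral_cong *)
  finally show ?thesis .
qed

lemma emeasure_kernel_prod:
  assumes \<kappa>: "\<kappa> \<in> M \<rightarrow>\<^sub>M prob_algebra N" and "space M \<noteq> {}" and A: "A \<in> sets (M \<Otimes>\<^sub>M N)"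
  shows "emeasure (kernel_prod M N \<kappa>) A = (\<integral>\<^sup>+x. \<integral>\<^sup>+y. indicator A (x, y) \<partial>\<kappa> x \<partial>M)"
  using nn_integral_kernel_prod[OF \<kappa>, of "indicator A"] A sets_kernel_prod[OF \<kappa> assms(2)]
  by simp

text \<open>The Fubini principle for null sets: a nonnegative integral that vanishes forces almost
  every section of a null set to be null.\<close>

lemma AE_kernel_prod:
  assumes \<kappa>: "\<kappa> \<in> M \<rightarrow>\<^sub>M prob_algebra N" and ne: "space M \<noteq> {}"
    and AE: "AE z in kernel_prod M N \<kappa>. P z"
  shows "AE x in M. AE y in \<kappa> x. P (x, y)"
proof -
  note sets = sets_kernel_prod[OF \<kappa> ne]
  \<comment> \<open>\<open>P\<close> may be non-measurable, so its exceptional set is replaced by a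
    measurable null set \<open>A\<close> containing it, whose sections can be integrated.\<close>
  obtain A where A: "{z \<in> space (kernel_prod M N \<kappa>). \<not> P z} \<subseteq> A"
    "emeasure (kernel_prod M N \<kappa>) A = 0" "A \<in> sets (M \<Otimes>\<^sub>M N)"
    using AE unfolding sets[symmetric] by (rule AE_E)
  have [measurable]: "indicator A \<in> borel_measurable (M \<Otimes>\<^sub>M N)"
    using A(3) by simp
  have "(\<integral>\<^sup>+x. \<integral>\<^sup>+y. indicator A (x, y) \<partial>\<kappa> x \<partial>M) = 0"
    using emeasure_kernel_prod[OF \<kappa> ne A(3)] A(2) by simp
  moreover have "(\<lambda>x. \<integral>\<^sup>+y. indicator A (x, y) \<partial>\<kappa> x) \<in> borel_measurable M"
    by (rule nn_integral_measurable_subprob_algebra2[OF _ measurable_prob_algebraD[OF \<kappa>]]) simp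
  ultimately have "AE x in M. (\<integral>\<^sup>+y. indicator A (x, y) \<partial>\<kappa> x) = 0"
    by (subst (asm) nn_integral_0_iff_AE) auto
  then show ?thesis
  proof (rule AE_mp[OF _ AE_I2[OF impI]])
    fix x assume x: "x \<in> space M" and 0: "(\<integral>\<^sup>+y. indicator A (x, y) \<partial>\<kappa> x) = 0"
    have "(\<lambda>y. indicator A (x, y) :: ennreal) \<in> borel_measurable (\<kappa> x)"
      using x by (subst measurable_cong_sets[OF prob_kernelD(2)[OF \<kappa> x] refl]) measurable
    then have "AE y in \<kappa> x. indicator A (x, y) = (0::ennreal)"
      using 0 by (subst (asm) nn_integral_0_iff_AE) auto
    then show "AE y in \<kappa> x. P (x, y)"
      by (rule AE_mp, intro AE_I2)
        (use A(1) x prob_kernelD(3)[OF \<kappa> x] sets_eq_imp_space_eq[OF sets]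
          in \<open>auto simp: space_pair_measure indicator_def split: if_splits\<close>)
  qed
qed

text \<open>For a fixed set \<open>A\<close>, integrating the mass of \<open>A\<close> under
  \<open>\<kappa> x\<close> over \<open>B\<close> gives the joint mass of the rectangle with sides
  \<open>B\<close> and \<open>A\<close>; hence the two kernels give \<open>A\<close> the same mass
  for almost every \<open>x\<close>. The exceptional null set depends on \<open>A\<close>, and
  countably many \<open>A\<close> allow a common one. If these sets also form an intersection-stable
  generator, the measures themselves agree off that null set.\<close>

lemma kernel_prod_unique:
  assumes M: "prob_space M"
    and \<kappa>: "\<kappa> \<in> M \<rightarrow>\<^sub>M prob_algebra N" and \<kappa>': "\<kappa>' \<in> M \<rightarrow>\<^sub>M prob_algebra N"
    and G: "countable G" "G \<subseteq> Pow (space N)" "sets N = sigma_sets (space N) G"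
    and eq: "kernel_prod M N \<kappa> = kernel_prod M N \<kappa>'"
  shows "AE x in M. \<kappa> x = \<kappa>' x"
proof -
  interpret prob_space M by fact
  \<comment> \<open>\<open>E\<close> closes \<open>G\<close> under finite intersections while
    staying countable. The empty family contributes \<open>space N\<close>, which later serves as
    the one-element cover of finite mass.\<close>
  define E where "E = (\<lambda>F. space N \<inter> \<Inter>F) ` {F. finite F \<and> F \<subseteq> G}"
  have "countable E"
    unfolding E_def by (intro countable_image countable_Collect_finite_subset G)
  have E_sub: "E \<subseteq> Pow (space N)"
    unfolding E_def by auto
  have "Int_stable E"
  proof (rule Int_stableI)
    fix a b assume "a \<in> E" "b \<in> E"
    then obtain F H where "finite F" "F \<subseteq> G" "finite H" "H \<subseteq> G"
      and ab: "a = space N \<inter> \<Inter>F" "b = space N \<inter> \<Inter>H"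
      unfolding E_def by auto
    then show "a \<inter> b \<in> E"
      unfolding E_def ab by (intro image_eqI[where x = "F \<union> H"]) auto
  qed
  have space_E: "space N \<in> E"
    unfolding E_def by (rule image_eqI[where x = "{}"]) auto
  have E_sets: "E \<subseteq> sets N"
  proof
    fix a assume "a \<in> E"
    then obtain F where F: "finite F" "F \<subseteq> G" "a = space N \<inter> \<Inter>F"
      unfolding E_def by auto
    have "space N \<inter> \<Inter>F \<in> sets N"
      using F(1,2)
    proof induction
      case (insert x F)
      have "x \<in> sets N" using insert.prems G(3) by auto
      then have "x \<inter> (space N \<inter> \<Inter>F) \<in> sets N" using insert by auto
      then show ?case by (simp add: Int_left_commute)
    qed simp
    then show "a \<in> sets N" using F by simp
  qed
  have "G \<subseteq> E"
    unfolding E_def using G(2) by (auto intro!: image_eqI[where x = "{g}" for g])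
  then have sets_E: "sets N = sigma_sets (space N) E"
    by (intro equalityI sets.sigma_sets_subset[OF E_sets]) (unfold G(3), rule sigma_sets_mono')
  have "AE x in M. emeasure (\<kappa> x) A = emeasure (\<kappa>' x) A" if "A \<in> E" for A
  proof (rule density_unique_finite_measure)
    have A[measurable]: "A \<in> sets N" using that E_sets by auto
    show "(\<lambda>x. emeasure (\<kappa> x) A) \<in> borel_measurable M" "(\<lambda>x. emeasure (\<kappa>' x) A) \<in> borel_measurable M"
      using measurable_prob_algebraD[OF \<kappa>] measurable_prob_algebraD[OF \<kappa>'] by measurable
    fix B assume B: "B \<in> sets M"
    have *: "(\<integral>\<^sup>+x. emeasure (k x) A * indicator B x \<partial>M) = emeasure (kernel_prod M N k) (B \<times> A)"
      if k: "k \<in> M \<rightarrow>\<^sub>M prob_algebra N" for k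
    proof -
      have "emeasure (kernel_prod M N k) (B \<times> A)
          = (\<integral>\<^sup>+x. \<integral>\<^sup>+y. indicator A y * indicator B x \<partial>k x \<partial>M)"
        using B by (subst emeasure_kernel_prod[OF k not_empty])
          (auto intro!: nn_integral_cong simp: indicator_def)
      also have "\<dots> = (\<integral>\<^sup>+x. emeasure (k x) A * indicator B x \<partial>M)"
        by (intro nn_integral_cong, subst nn_integral_multc)
          (auto simp: prob_kernelD(2)[OF k] intro!: borel_measurable_indicator)
      finally show ?thesis ..
    qed
    show "(\<integral>\<^sup>+x. emeasure (\<kappa> x) A * indicator B x \<partial>M) = (\<integral>\<^sup>+x. emeasure (\<kappa>' x) A * indicator B x \<partial>M)"
      using *[OF \<kappa>] *[OF \<kappa>'] eq by simp
  qed auto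
  then have "AE x in M. \<forall>A\<in>E. emeasure (\<kappa> x) A = emeasure (\<kappa>' x) A"
    by (simp add: AE_ball_countable \<open>countable E\<close>)
  then show ?thesis
  proof (rule AE_mp, intro AE_I2 impI)
    fix x assume x: "x \<in> space M" and eqE: "\<forall>A\<in>E. emeasure (\<kappa> x) A = emeasure (\<kappa>' x) A"
    interpret kx: prob_space "\<kappa> x" by (rule prob_kernelD(1)[OF \<kappa> x])
    show "\<kappa> x = \<kappa>' x"
    proof (rule measure_eqI_generator_eq_countable[OF \<open>Int_stable E\<close> E_sub, where A = "{space N}"])
      show "sets (\<kappa> x) = sigma_sets (space N) E" "sets (\<kappa>' x) = sigma_sets (space N) E"
        unfolding prob_kernelD(2)[OF \<kappa> x] prob_kernelD(2)[OF \<kappa>' x] by (fact sets_E)+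
    qed (use eqE space_E kx.emeasure_finite in \<open>auto simp: top_unique\<close>)
  qed
qed


lemma kernel_prod_cong_AE:
  assumes \<kappa>: "\<kappa> \<in> M \<rightarrow>\<^sub>M prob_algebra N" and \<kappa>': "\<kappa>' \<in> M \<rightarrow>\<^sub>M prob_algebra N"
    and ne: "space M \<noteq> {}" and eq: "AE x in M. \<kappa> x = \<kappa>' x"
  shows "kernel_prod M N \<kappa> = kernel_prod M N \<kappa>'"
proof (rule measure_eqI)
  fix A assume "A \<in> sets (kernel_prod M N \<kappa>)"
  then have A: "A \<in> sets (M \<Otimes>\<^sub>M N)" by (simp add: sets_kernel_prod[OF \<kappa> ne])
  show "emeasure (kernel_prod M N \<kappa>) A = emeasure (kernel_prod M N \<kappa>') A"
    unfolding emeasure_kernel_prod[OF \<kappa> ne A] emeasure_kernel_prod[OF \<kappa>' ne A]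
    by (intro nn_integral_cong_AE) (use eq in auto)
qed (simp add: sets_kernel_prod[OF \<kappa> ne] sets_kernel_prod[OF \<kappa>' ne])

text \<open>Barycentric couplings are formed over the conditional law \<open>\<kappa>23 x2\<close>,
  whereas the kernels are built over \<open>\<mu>3\<close>; this passes between the two.\<close>

lemma kernel_prod_cong_sets:
  assumes "sets N = sets N'"
  shows "kernel_prod M N \<kappa> = kernel_prod M N' \<kappa>"
  unfolding kernel_prod_def return_cong[OF sets_pair_measure_cong[OF refl[of "sets M"] assms]] ..

lemma prob_algebra_cong: "sets M = sets N \<Longrightarrow> prob_algebra M = prob_algebra N"
  unfolding prob_algebra_def by (drule subprob_algebra_cong) (simp only:)

section \<open>Uniqueness, images and composition of disintegrations\<close>

lemma disintegrates_unique:
  assumes "prob_space \<mu>" "countable G" "G \<subseteq> Pow (space N)" "sets N = sigma_sets (space N) G"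
    and "disintegrates \<pi> f \<mu> g N \<kappa>" "disintegrates \<pi> f \<mu> g N \<kappa>'"
  shows "AE x in \<mu>. \<kappa> x = \<kappa>' x"
  using assms unfolding disintegrates_def by (intro kernel_prod_unique[of \<mu> \<kappa> N \<kappa>' G]) auto

text \<open>Conditional laws push forward along maps of the conditioned variable. Applied with
  \<open>fst\<close> and \<open>snd\<close>, this turns the conditional law of (x1, x3) given x2
  into those of x1 and of x3.\<close>

lemma disintegrates_distr:
  assumes f: "f \<in> \<pi> \<rightarrow>\<^sub>M \<mu>" and g: "g \<in> \<pi> \<rightarrow>\<^sub>M N" and h: "h \<in> N \<rightarrow>\<^sub>M N'"
    and ne: "space \<mu> \<noteq> {}" and D: "disintegrates \<pi> f \<mu> g N \<kappa>"
  shows "disintegrates \<pi> f \<mu> (\<lambda>\<omega>. h (g \<omega>)) N' (\<lambda>x. distr (\<kappa> x) N' h)"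
proof -
  note [measurable] = f g h
  have \<kappa>[measurable]: "\<kappa> \<in> \<mu> \<rightarrow>\<^sub>M prob_algebra N"
    and eq: "distr \<pi> (\<mu> \<Otimes>\<^sub>M N) (\<lambda>\<omega>. (f \<omega>, g \<omega>)) = kernel_prod \<mu> N \<kappa>"
    using D by (auto simp: disintegrates_def)
  have \<kappa>': "(\<lambda>x. distr (\<kappa> x) N' h) \<in> \<mu> \<rightarrow>\<^sub>M prob_algebra N'"
    by measurable
  have "distr \<pi> (\<mu> \<Otimes>\<^sub>M N') (\<lambda>\<omega>. (f \<omega>, h (g \<omega>)))
      = distr (kernel_prod \<mu> N \<kappa>) (\<mu> \<Otimes>\<^sub>M N') (\<lambda>(x, y). (x, h y))"
    unfolding eq[symmetric] by (subst distr_distr) (auto simp: comp_def)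
  also have "\<dots> = kernel_prod \<mu> N' (\<lambda>x. distr (\<kappa> x) N' h)"
  proof (rule measure_eqI)
    note [measurable_cong] = sets_kernel_prod[OF \<kappa> ne]
    fix A assume "A \<in> sets (distr (kernel_prod \<mu> N \<kappa>) (\<mu> \<Otimes>\<^sub>M N') (\<lambda>(x, y). (x, h y)))"
    then have A[measurable]: "A \<in> sets (\<mu> \<Otimes>\<^sub>M N')" by simp
    have "emeasure (distr (kernel_prod \<mu> N \<kappa>) (\<mu> \<Otimes>\<^sub>M N') (\<lambda>(x, y). (x, h y))) A
        = (\<integral>\<^sup>+z. indicator A z \<partial>distr (kernel_prod \<mu> N \<kappa>) (\<mu> \<Otimes>\<^sub>M N') (\<lambda>(x, y). (x, h y)))"
      by simp
    also have "\<dots> = (\<integral>\<^sup>+z. indicator A (case z of (x, y) \<Rightarrow> (x, h y)) \<partial>kernel_prod \<mu> N \<kappa>)"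
      by (rule nn_integral_distr) measurable
    also have "\<dots> = (\<integral>\<^sup>+x. \<integral>\<^sup>+y. indicator A (x, h y) \<partial>\<kappa> x \<partial>\<mu>)"
      by (subst nn_integral_kernel_prod[OF \<kappa>]) simp_all
    also have "\<dots> = (\<integral>\<^sup>+x. \<integral>\<^sup>+y. indicator A (x, y) \<partial>distr (\<kappa> x) N' h \<partial>\<mu>)"
    proof (rule nn_integral_cong)
      fix x assume x: "x \<in> space \<mu>"
      note [measurable_cong] = prob_kernelD(2)[OF \<kappa> x]
      show "(\<integral>\<^sup>+y. indicator A (x, h y) \<partial>\<kappa> x) = (\<integral>\<^sup>+y. indicator A (x, y) \<partial>distr (\<kappa> x) N' h)"
        using x by (subst nn_integral_distr) auto
    qed
    also have "\<dots> = emeasure (kernel_prod \<mu> N' (\<lambda>x. distr (\<kappa> x) N' h)) A"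
      by (rule emeasure_kernel_prod[OF \<kappa>' ne A, symmetric])
    finally show "emeasure (distr (kernel_prod \<mu> N \<kappa>) (\<mu> \<Otimes>\<^sub>M N') (\<lambda>(x, y). (x, h y))) A
        = emeasure (kernel_prod \<mu> N' (\<lambda>x. distr (\<kappa> x) N' h)) A" .
  qed (simp add: sets_kernel_prod[OF \<kappa>' ne])
  finally show ?thesis
    using \<kappa>' by (simp add: disintegrates_def)
qed

text \<open>\<open>kernel_prod\<close> lists the conditioning variable first, while the coupling of
  x1 and x2 is conditioned on its second coordinate; the swap reconciles the two orders.\<close>

lemma distr_eq_distr_kernel_prod:
  assumes [measurable]: "f \<in> \<pi> \<rightarrow>\<^sub>M \<mu>" "g \<in> \<pi> \<rightarrow>\<^sub>M \<nu>" and D: "disintegrates \<pi> g \<nu> f \<mu> \<kappa>"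
  shows "distr \<pi> (\<mu> \<Otimes>\<^sub>M \<nu>) (\<lambda>\<omega>. (f \<omega>, g \<omega>)) = distr (kernel_prod \<nu> \<mu> \<kappa>) (\<mu> \<Otimes>\<^sub>M \<nu>) prod.swap"
proof -
  have eq: "kernel_prod \<nu> \<mu> \<kappa> = distr \<pi> (\<nu> \<Otimes>\<^sub>M \<mu>) (\<lambda>\<omega>. (g \<omega>, f \<omega>))"
    using D by (simp add: disintegrates_def)
  have "prod.swap \<in> \<nu> \<Otimes>\<^sub>M \<mu> \<rightarrow>\<^sub>M \<mu> \<Otimes>\<^sub>M \<nu>"
    unfolding prod.swap_def by measurable
  then show ?thesis
    unfolding eq by (subst distr_distr) (auto simp: comp_def)
qed

text \<open>This carries the martingale property at time 2, an almost sure statement about (x1, x2),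
  to the fibres over x2, where the barycenter condition is stated.\<close>

lemma AE_disintegrates:
  assumes meas: "f \<in> \<pi> \<rightarrow>\<^sub>M \<mu>" "g \<in> \<pi> \<rightarrow>\<^sub>M \<nu>" and ne: "space \<nu> \<noteq> {}"
    and D: "disintegrates \<pi> g \<nu> f \<mu> \<kappa>"
    and AE: "AE z in distr \<pi> (\<mu> \<Otimes>\<^sub>M \<nu>) (\<lambda>\<omega>. (f \<omega>, g \<omega>)). P z"
  shows "AE y in \<nu>. AE x in \<kappa> y. P (x, y)"
proof -
  have \<kappa>: "\<kappa> \<in> \<nu> \<rightarrow>\<^sub>M prob_algebra \<mu>"
    using D by (simp add: disintegrates_def)
  note [measurable_cong] = sets_kernel_prod[OF \<kappa> ne]
  have "prod.swap \<in> kernel_prod \<nu> \<mu> \<kappa> \<rightarrow>\<^sub>M \<mu> \<Otimes>\<^sub>M \<nu>"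
    unfolding prod.swap_def by measurable
  from AE_distrD[OF this AE[unfolded distr_eq_distr_kernel_prod[OF meas D]]]
  show ?thesis
    using AE_kernel_prod[OF \<kappa> ne] by fastforce
qed

text \<open>The joint law can be sampled in three stages: y from \<open>\<nu>\<close>, then x from
  \<open>\<kappa> y\<close>, then z from \<open>K (x, y)\<close>. The last two stages, for fixed y,
  are the conditional law of (x, z). The proof compares integrals of indicators, written as iterated
  integrals in this order.\<close>

lemma disintegrates_chain:
  fixes f :: "'o \<Rightarrow> 'a" and g :: "'o \<Rightarrow> 'b" and h :: "'o \<Rightarrow> 'c"
  assumes f[measurable]: "f \<in> \<pi> \<rightarrow>\<^sub>M \<mu>" and g[measurable]: "g \<in> \<pi> \<rightarrow>\<^sub>M \<nu>"
    and h[measurable]: "h \<in> \<pi> \<rightarrow>\<^sub>M N"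
    and ne: "space \<nu> \<noteq> {}"
    and D: "disintegrates \<pi> g \<nu> f \<mu> \<kappa>"
    and E: "disintegrates \<pi> (\<lambda>\<omega>. (f \<omega>, g \<omega>)) (distr \<pi> (\<mu> \<Otimes>\<^sub>M \<nu>) (\<lambda>\<omega>. (f \<omega>, g \<omega>))) h N K"
  shows "disintegrates \<pi> g \<nu> (\<lambda>\<omega>. (f \<omega>, h \<omega>)) (\<mu> \<Otimes>\<^sub>M N)
    (\<lambda>y. kernel_prod (\<kappa> y) N (\<lambda>x. K (x, y)))"
proof -
  define L where "L = (\<lambda>y. kernel_prod (\<kappa> y) N (\<lambda>x. K (x, y)))"
  let ?P = "distr \<pi> (\<mu> \<Otimes>\<^sub>M \<nu>) (\<lambda>\<omega>. (f \<omega>, g \<omega>))"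
  have \<kappa>[measurable]: "\<kappa> \<in> \<nu> \<rightarrow>\<^sub>M prob_algebra \<mu>"
    using D by (simp add: disintegrates_def)
  have K': "K \<in> ?P \<rightarrow>\<^sub>M prob_algebra N"
    and eqK: "distr \<pi> (?P \<Otimes>\<^sub>M N) (\<lambda>\<omega>. ((f \<omega>, g \<omega>), h \<omega>)) = kernel_prod ?P N K"
    using E by (simp_all add: disintegrates_def)
  have K[measurable]: "K \<in> \<mu> \<Otimes>\<^sub>M \<nu> \<rightarrow>\<^sub>M prob_algebra N"
    using K' by simp
  have Ky: "(\<lambda>x. K (x, y)) \<in> \<kappa> y \<rightarrow>\<^sub>M prob_algebra N" if "y \<in> space \<nu>" for y
    using that by (subst measurable_cong_sets[OF prob_kernelD(2)[OF \<kappa> that] refl]) measurable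
  \<comment> \<open>The \<open>return\<close> inside \<open>kernel_prod (\<kappa> y) N\<close> lives
    on a product space that varies with y. Replacing it by one on the fixed
    \<open>\<mu> \<Otimes>\<^sub>M N\<close>, which has the same sigma-algebra, makes measurability
    in y accessible.\<close>
  have L_eq: "L y = bind (\<kappa> y) (\<lambda>x. bind (K (x, y)) (\<lambda>z. return (\<mu> \<Otimes>\<^sub>M N) (x, z)))"
    if "y \<in> space \<nu>" for y
    unfolding L_def kernel_prod_def
      return_cong[OF sets_pair_measure_cong[OF prob_kernelD(2)[OF \<kappa> that] refl[of "sets N"]]] ..
  have L: "L \<in> \<nu> \<rightarrow>\<^sub>M prob_algebra (\<mu> \<Otimes>\<^sub>M N)"
    by (subst measurable_cong[OF L_eq]) measurable
  have "distr \<pi> (\<nu> \<Otimes>\<^sub>M (\<mu> \<Otimes>\<^sub>M N)) (\<lambda>\<omega>. (g \<omega>, (f \<omega>, h \<omega>))) = kernel_prod \<nu> (\<mu> \<Otimes>\<^sub>M N) L"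
  proof (rule measure_eqI)
    fix A assume "A \<in> sets (distr \<pi> (\<nu> \<Otimes>\<^sub>M (\<mu> \<Otimes>\<^sub>M N)) (\<lambda>\<omega>. (g \<omega>, (f \<omega>, h \<omega>))))"
    then have A[measurable]: "A \<in> sets (\<nu> \<Otimes>\<^sub>M (\<mu> \<Otimes>\<^sub>M N))" by simp
    let ?I = "\<lambda>x y z. indicator A (y, x, z) :: ennreal"
    have inner: "(\<lambda>w. \<integral>\<^sup>+z. ?I (fst w) (snd w) z \<partial>K w) \<in> borel_measurable (\<mu> \<Otimes>\<^sub>M \<nu>)"
      by (rule nn_integral_measurable_subprob_algebra2[OF _ measurable_prob_algebraD[OF K]]) measurable
    note [measurable_cong] = sets_kernel_prod[OF \<kappa> ne]
    have swap: "prod.swap \<in> kernel_prod \<nu> \<mu> \<kappa> \<rightarrow>\<^sub>M \<mu> \<Otimes>\<^sub>M \<nu>" "prod.swap \<in> \<nu> \<Otimes>\<^sub>M \<mu> \<rightarrow>\<^sub>M \<mu> \<Otimes>\<^sub>M \<nu>"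
      unfolding prod.swap_def by measurable
    have "emeasure (distr \<pi> (\<nu> \<Otimes>\<^sub>M (\<mu> \<Otimes>\<^sub>M N)) (\<lambda>\<omega>. (g \<omega>, (f \<omega>, h \<omega>)))) A
        = (\<integral>\<^sup>+w. indicator A w \<partial>distr \<pi> (\<nu> \<Otimes>\<^sub>M (\<mu> \<Otimes>\<^sub>M N)) (\<lambda>\<omega>. (g \<omega>, (f \<omega>, h \<omega>))))"
      by simp
    also have "\<dots> = (\<integral>\<^sup>+\<omega>. ?I (f \<omega>) (g \<omega>) (h \<omega>) \<partial>\<pi>)"
      by (rule nn_integral_distr) measurable
    also have "\<dots> = (\<integral>\<^sup>+w. ?I (fst (fst w)) (snd (fst w)) (snd w) \<partial>kernel_prod ?P N K)"
      unfolding eqK[symmetric] by (subst nn_integral_distr) simp_all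
    also have "\<dots> = (\<integral>\<^sup>+w. \<integral>\<^sup>+z. ?I (fst w) (snd w) z \<partial>K w \<partial>?P)"
      by (subst nn_integral_kernel_prod[OF K']) simp_all
    \<comment> \<open>The law of (x, y) is rewritten as a swapped kernel product, so that y becomes
      the outer variable of integration.\<close>
    also have "\<dots> = (\<integral>\<^sup>+w. \<integral>\<^sup>+z. ?I (snd w) (fst w) z \<partial>K (prod.swap w) \<partial>kernel_prod \<nu> \<mu> \<kappa>)"
      unfolding distr_eq_distr_kernel_prod[OF f g D]
      by (subst nn_integral_distr[OF swap(1)]) (use inner in simp_all)
    also have "\<dots> = (\<integral>\<^sup>+y. \<integral>\<^sup>+x. \<integral>\<^sup>+z. ?I x y z \<partial>K (x, y) \<partial>\<kappa> y \<partial>\<nu>)"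
      using measurable_compose[OF swap(2) inner] by (subst nn_integral_kernel_prod[OF \<kappa>]) simp_all
    also have "\<dots> = (\<integral>\<^sup>+y. \<integral>\<^sup>+w. indicator A (y, w) \<partial>L y \<partial>\<nu>)"
    proof (rule nn_integral_cong)
      fix y assume y: "y \<in> space \<nu>"
      note [measurable_cong] = prob_kernelD(2)[OF \<kappa> y]
      show "(\<integral>\<^sup>+x. \<integral>\<^sup>+z. ?I x y z \<partial>K (x, y) \<partial>\<kappa> y) = (\<integral>\<^sup>+w. indicator A (y, w) \<partial>L y)"
        unfolding L_def using y by (subst nn_integral_kernel_prod[OF Ky[OF y]]) simp_all
    qed
    also have "\<dots> = emeasure (kernel_prod \<nu> (\<mu> \<Otimes>\<^sub>M N) L) A"
      by (rule emeasure_kernel_prod[OF L ne A, symmetric])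
    finally show "emeasure (distr \<pi> (\<nu> \<Otimes>\<^sub>M (\<mu> \<Otimes>\<^sub>M N)) (\<lambda>\<omega>. (g \<omega>, (f \<omega>, h \<omega>)))) A
      = emeasure (kernel_prod \<nu> (\<mu> \<Otimes>\<^sub>M N) L) A" .
  qed (simp add: sets_kernel_prod[OF L ne])
  then show ?thesis
    using L by (simp add: disintegrates_def L_def)
qed

section \<open>Gluing martingale couplings of measures on compact sets\<close>

lemma borel_probsE:
  assumes "compact X" "\<mu> \<in> borel_probs X"
  obtains G where "prob_space \<mu>" "countable G" "G \<subseteq> Pow (space \<mu>)" "sets \<mu> = sigma_sets (space \<mu>) G"
proof -
  have \<mu>: "prob_space \<mu>" "sets \<mu> = sets (restrict_space borel X)"
    using assms(2) by (auto simp: borel_probs_def space_prob_algebra)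
  obtain G where "countable G" "G \<subseteq> Pow X" "sets (restrict_space borel X) = sigma_sets X G"
    using sets_restrict_borel_countably_generated[OF borel_compact[OF assms(1)]] .
  moreover have "space \<mu> = X"
    using sets_eq_imp_space_eq[OF \<mu>(2)] by (simp add: space_restrict_space)
  ultimately show ?thesis
    using \<mu> by (intro that) auto
qed

theorem lemma2p1:
  fixes X1 X2 X3 :: "'a::euclidean_space set"
    and \<mu>1 \<mu>2 \<mu>3 :: "'a measure"
    and \<pi>12 \<pi>23 :: "('a \<times> 'a) measure"
    and \<kappa>21 \<kappa>23 :: "'a \<Rightarrow> 'a measure"
  assumes "compact X1" and "compact X2" and "compact X3"
    and "\<mu>1 \<in> borel_probs X1" and "\<mu>2 \<in> borel_probs X2" and "\<mu>3 \<in> borel_probs X3"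
    and "\<mu>1 \<preceq>\<^sub>c \<mu>2" and "\<mu>2 \<preceq>\<^sub>c \<mu>3"
    and "\<pi>12 \<in> mart_couplings2 \<mu>1 \<mu>2" and "disintegrates \<pi>12 snd \<mu>2 fst \<mu>1 \<kappa>21"
    and "\<pi>23 \<in> mart_couplings2 \<mu>2 \<mu>3" and "disintegrates \<pi>23 fst \<mu>2 snd \<mu>3 \<kappa>23"
  shows "{\<pi> \<in> mart_couplings3 \<mu>1 \<mu>2 \<mu>3. proj12 \<mu>1 \<mu>2 \<pi> = \<pi>12 \<and> proj23 \<mu>2 \<mu>3 \<pi> = \<pi>23} =
    {\<pi> \<in> mart_couplings3 \<mu>1 \<mu>2 \<mu>3.
      \<exists>\<kappa>. disintegrates \<pi> (\<lambda>(x1, x2, x3). x2) \<mu>2 (\<lambda>(x1, x2, x3). (x1, x3)) (\<mu>1 \<Otimes>\<^sub>M \<mu>3) \<kappa> \<and>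
          (AE x2 in \<mu>2. \<kappa> x2 \<in> bary_couplings (\<lambda>x1. x2) (\<kappa>21 x2) (\<kappa>23 x2))}"
proof -
  let ?p1 = "\<lambda>(x1, x2, x3). x1 :: 'a" and ?p2 = "\<lambda>(x1, x2, x3). x2 :: 'a"
    and ?p3 = "\<lambda>(x1, x2, x3). x3 :: 'a"
  \<comment> \<open>Tupled coordinate maps match the form (f, g) in which the lemmas on
    disintegrations are stated.\<close>
  have pair12: "(\<lambda>(x1, x2, x3). (x1, x2)) = (\<lambda>\<omega>. (?p1 \<omega>, ?p2 \<omega>))"
    and pair13: "(\<lambda>(x1, x2, x3). (x1, x3)) = (\<lambda>\<omega>. (?p1 \<omega>, ?p3 \<omega>))"
    and pair23: "(\<lambda>(x1, x2, x3). (x2, x3)) = (\<lambda>\<omega>. (?p2 \<omega>, ?p3 \<omega>))"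
    by (auto simp: fun_eq_iff)
  \<comment> \<open>The conditional laws to be identified almost everywhere live on the first and
    third spaces, so countable generators are taken there.\<close>
  obtain G1 where G1: "countable G1" "G1 \<subseteq> Pow (space \<mu>1)" "sets \<mu>1 = sigma_sets (space \<mu>1) G1"
    using borel_probsE[OF assms(1,4)] .
  obtain G3 where G3: "countable G3" "G3 \<subseteq> Pow (space \<mu>3)" "sets \<mu>3 = sigma_sets (space \<mu>3) G3"
    using borel_probsE[OF assms(3,6)] .
  interpret \<mu>2: prob_space \<mu>2
    using borel_probsE[OF assms(2,5)] .
  note ne = \<mu>2.not_empty
  have \<kappa>21: "\<kappa>21 \<in> \<mu>2 \<rightarrow>\<^sub>M prob_algebra \<mu>1" and \<kappa>23: "\<kappa>23 \<in> \<mu>2 \<rightarrow>\<^sub>M prob_algebra \<mu>3"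
    using assms(10,12) by (auto simp: disintegrates_def)
  have sets12[measurable_cong]: "sets \<pi>12 = sets (\<mu>1 \<Otimes>\<^sub>M \<mu>2)"
    and sets23[measurable_cong]: "sets \<pi>23 = sets (\<mu>2 \<Otimes>\<^sub>M \<mu>3)"
    using assms(9,11) by (auto simp: mart_couplings2_def couplings2_def space_prob_algebra)
  \<comment> \<open>Both sets consist of martingale couplings, so it suffices to compare their
    defining conditions for one fixed such coupling.\<close>
  have "proj12 \<mu>1 \<mu>2 \<pi> = \<pi>12 \<and> proj23 \<mu>2 \<mu>3 \<pi> = \<pi>23 \<longleftrightarrow>
      (\<exists>\<kappa>. disintegrates \<pi> ?p2 \<mu>2 (\<lambda>(x1, x2, x3). (x1, x3)) (\<mu>1 \<Otimes>\<^sub>M \<mu>3) \<kappa> \<and>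
        (AE x2 in \<mu>2. \<kappa> x2 \<in> bary_couplings (\<lambda>x1. x2) (\<kappa>21 x2) (\<kappa>23 x2)))"
    (is "?proj \<longleftrightarrow> (\<exists>\<kappa>. ?dis \<kappa> \<and> ?bary \<kappa>)")
    if \<pi>: "\<pi> \<in> mart_couplings3 \<mu>1 \<mu>2 \<mu>3" for \<pi>
  proof -
    have [measurable_cong]: "sets \<pi> = sets (\<mu>1 \<Otimes>\<^sub>M (\<mu>2 \<Otimes>\<^sub>M \<mu>3))"
      using \<pi> by (auto simp: mart_couplings3_def couplings3_def space_prob_algebra)
    have p[measurable]: "?p1 \<in> \<pi> \<rightarrow>\<^sub>M \<mu>1" "?p2 \<in> \<pi> \<rightarrow>\<^sub>M \<mu>2" "?p3 \<in> \<pi> \<rightarrow>\<^sub>M \<mu>3"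
      by measurable
    have marginals:
      "disintegrates \<pi> ?p2 \<mu>2 ?p1 \<mu>1 (\<lambda>x. distr (\<kappa> x) \<mu>1 fst)"
      "disintegrates \<pi> ?p2 \<mu>2 ?p3 \<mu>3 (\<lambda>x. distr (\<kappa> x) \<mu>3 snd)"
      if "?dis \<kappa>" for \<kappa>
      using disintegrates_distr[OF p(2) _ measurable_fst ne that[unfolded pair13]]
        disintegrates_distr[OF p(2) _ measurable_snd ne that[unfolded pair13]]
      by simp_all
    show ?thesis
    proof
      assume proj: ?proj
      obtain K where
        K: "disintegrates \<pi> (\<lambda>\<omega>. (?p1 \<omega>, ?p2 \<omega>)) (distr \<pi> (\<mu>1 \<Otimes>\<^sub>M \<mu>2) (\<lambda>\<omega>. (?p1 \<omega>, ?p2 \<omega>))) ?p3 \<mu>3 K"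
        and K_bary: "AE (x1, x2) in distr \<pi> (\<mu>1 \<Otimes>\<^sub>M \<mu>2) (\<lambda>\<omega>. (?p1 \<omega>, ?p2 \<omega>)). (\<integral>x3. x3 \<partial>K (x1, x2)) = x2"
        using \<pi> unfolding mart_couplings3_def proj12_def pair12 by blast
      \<comment> \<open>Only the law of (x1, x2) enters this disintegration, and it is
        \<open>\<pi>12\<close>; so \<open>\<kappa>21\<close> is also the conditional law of x1 given
        x2 under \<open>\<pi>\<close>. The same holds for \<open>\<kappa>23\<close> and x3.\<close>
      have D1: "disintegrates \<pi> ?p2 \<mu>2 ?p1 \<mu>1 \<kappa>21"
        using assms(10) conjunct1[OF proj] p
        by (auto simp: disintegrates_def proj12_def pair12 distr_distr comp_def)
      have D3: "disintegrates \<pi> ?p2 \<mu>2 ?p3 \<mu>3 \<kappa>23"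
        using assms(12) distr_id2[OF sets23[symmetric]] conjunct2[OF proj, unfolded proj23_def pair23]
        by (simp add: disintegrates_def id_def)
      let ?L = "\<lambda>x2. kernel_prod (\<kappa>21 x2) \<mu>3 (\<lambda>x1. K (x1, x2))"
      have D: "?dis ?L"
        unfolding pair13 by (rule disintegrates_chain[OF p(1,2,3) ne D1 K])
      have K_meas: "K \<in> \<mu>1 \<Otimes>\<^sub>M \<mu>2 \<rightarrow>\<^sub>M prob_algebra \<mu>3"
        using K by (simp add: disintegrates_def)
      \<comment> \<open>Four almost sure facts are combined: the first marginal of
        \<open>?L x2\<close> is \<open>\<kappa>21 x2\<close> and the second is
        \<open>\<kappa>23 x2\<close>, both by uniqueness of disintegrations;
        \<open>K (x1, x2)\<close> has barycenter x2 for almost every x1 under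
        \<open>\<kappa>21 x2\<close>; and x2 lies in the space of \<open>\<mu>2\<close>.\<close>
      have "?bary ?L"
        using disintegrates_unique[OF \<mu>2.prob_space_axioms G1 marginals(1)[OF D] D1]
          disintegrates_unique[OF \<mu>2.prob_space_axioms G3 marginals(2)[OF D] D3]
          AE_disintegrates[OF p(1,2) ne D1 K_bary] AE_space
      proof eventually_elim
        case (elim x2)
        \<comment> \<open>The couplings in \<open>bary_couplings\<close> live over
          \<open>\<kappa>21 x2\<close> and \<open>\<kappa>23 x2\<close>. Their sigma-algebras are
          those of \<open>\<mu>1\<close> and \<open>\<mu>3\<close>, so marginals and kernels
          transfer.\<close>
        have s1: "sets (\<kappa>21 x2) = sets \<mu>1" and s3: "sets (\<kappa>23 x2) = sets \<mu>3"
          using prob_kernelD(2)[OF \<kappa>21 elim(4)] prob_kernelD(2)[OF \<kappa>23 elim(4)] .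
        have L: "prob_space (?L x2)" "sets (?L x2) = sets (\<kappa>21 x2 \<Otimes>\<^sub>M \<kappa>23 x2)"
          using D prob_kernelD[OF _ elim(4), of ?L] sets_pair_measure_cong[OF s1 s3]
          by (auto simp: disintegrates_def)
        have "?L x2 \<in> couplings2 (\<kappa>21 x2) (\<kappa>23 x2)"
          using elim(1,2) L distr_cong[OF refl s1, of "?L x2" fst fst]
            distr_cong[OF refl s3, of "?L x2" snd snd]
          by (simp add: couplings2_def space_prob_algebra)
        \<comment> \<open>\<open>?L x2\<close> is by construction the product of
          \<open>\<kappa>21 x2\<close> with this kernel, which is therefore the witness for the
          barycenter condition.\<close>
        moreover have "(\<lambda>x1. K (x1, x2)) \<in> \<kappa>21 x2 \<rightarrow>\<^sub>M prob_algebra (\<kappa>23 x2)"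
          unfolding prob_algebra_cong[OF s3] measurable_cong_sets[OF s1 refl]
          using K_meas elim(4) by measurable
        moreover have "distr (?L x2) (\<kappa>21 x2 \<Otimes>\<^sub>M \<kappa>23 x2) (\<lambda>\<omega>. (fst \<omega>, snd \<omega>)) = ?L x2"
          using distr_id2[OF L(2)[symmetric]] by (simp add: id_def)
        ultimately show ?case
          using elim(3) kernel_prod_cong_sets[OF s3, of "\<kappa>21 x2" "\<lambda>x1. K (x1, x2)"]
          by (auto simp: bary_couplings_def disintegrates_def intro!: exI[of _ "\<lambda>x1. K (x1, x2)"])
      qed
      with D show "\<exists>\<kappa>. ?dis \<kappa> \<and> ?bary \<kappa>" by blast
    next
      assume "\<exists>\<kappa>. ?dis \<kappa> \<and> ?bary \<kappa>"
      then obtain \<kappa> where dis: "?dis \<kappa>" and bary: "?bary \<kappa>" by blast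
      note D = marginals[OF dis]
      \<comment> \<open>Being a coupling of \<open>\<kappa>21 x2\<close> and
        \<open>\<kappa>23 x2\<close> fixes both marginals of \<open>\<kappa> x2\<close>; with the
        law \<open>\<mu>2\<close> of x2 they determine the two projections.\<close>
      have "AE x2 in \<mu>2. distr (\<kappa> x2) \<mu>1 fst = \<kappa>21 x2 \<and> distr (\<kappa> x2) \<mu>3 snd = \<kappa>23 x2"
        using bary AE_space
      proof eventually_elim
        case (elim x2)
        show ?case
          using elim(1) distr_cong[OF refl prob_kernelD(2)[OF \<kappa>21 elim(2)], of "\<kappa> x2" fst fst]
            distr_cong[OF refl prob_kernelD(2)[OF \<kappa>23 elim(2)], of "\<kappa> x2" snd snd]
          by (simp add: bary_couplings_def couplings2_def)
      qed
      then have AE: "AE x2 in \<mu>2. distr (\<kappa> x2) \<mu>1 fst = \<kappa>21 x2" "AE x2 in \<mu>2. distr (\<kappa> x2) \<mu>3 snd = \<kappa>23 x2"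
        by auto
      \<comment> \<open>Both sides are swapped kernel products over \<open>\<mu>2\<close>, with
        kernels equal almost everywhere.\<close>
      have "distr \<pi> (\<mu>1 \<Otimes>\<^sub>M \<mu>2) (\<lambda>\<omega>. (?p1 \<omega>, ?p2 \<omega>)) = distr \<pi>12 (\<mu>1 \<Otimes>\<^sub>M \<mu>2) (\<lambda>\<omega>. (fst \<omega>, snd \<omega>))"
        using kernel_prod_cong_AE[OF _ \<kappa>21 ne AE(1)] D(1)
          distr_eq_distr_kernel_prod[OF p(1,2) D(1)]
          distr_eq_distr_kernel_prod[of fst \<pi>12 \<mu>1 snd \<mu>2, OF _ _ assms(10)]
        by (simp add: disintegrates_def)
      then have "proj12 \<mu>1 \<mu>2 \<pi> = \<pi>12"
        using distr_id2[OF sets12[symmetric]] unfolding proj12_def pair12 by (simp add: id_def)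
      \<comment> \<open>Here the conditioning variable x2 already comes first, so the kernel
        products are compared without a swap.\<close>
      moreover have "distr \<pi> (\<mu>2 \<Otimes>\<^sub>M \<mu>3) (\<lambda>\<omega>. (?p2 \<omega>, ?p3 \<omega>)) = distr \<pi>23 (\<mu>2 \<Otimes>\<^sub>M \<mu>3) (\<lambda>\<omega>. (fst \<omega>, snd \<omega>))"
        using kernel_prod_cong_AE[OF _ \<kappa>23 ne AE(2)] D(2) assms(12)
        by (simp add: disintegrates_def)
      then have "proj23 \<mu>2 \<mu>3 \<pi> = \<pi>23"
        using distr_id2[OF sets23[symmetric]] unfolding proj23_def pair23 by (simp add: id_def)
      ultimately show ?proj ..
    qed
  qed
  then show ?thesis
    by (intro Collect_cong conj_cong refl)
qed

end
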